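(* Let $\mathbb{F}$ be $\mathbb{R}$ or $\mathbb{C}$, let $\bm{\rho}=(\bm{\rho}_1,\ldots,\bm{\rho}_d)\in(\mathbb{F}^d)^d$ be a tuple of $\mathbb{F}$-linearly independent unit vectors, let $h$ be a nonzero number in $\mathbb{F}$, and let $\bm{\alpha}\in\mathbb{N}^d$, $\bm{\xi}\in\mathbb{F}^d$. Then for every $p\in\mathbb{F}[x_1,\ldots,x_d]$, $$\frac{1}{h^{\|\bm{\alpha}\|_1}}\sum_{\bm{0}\le\bm{\beta}\le\bm{\alpha}}(-1)^{\|\bm{\alpha}-\bm{\beta}\|_1}\binom{\bm{\alpha}}{\bm{\beta}}\,p\Big(\bm{\xi}+h\sum_{i=1}^d\beta_i\bm{\rho}_i\Big)=(D^{\bm{\alpha}}_{\bm{\rho}}p)(\bm{\xi})+O(h),$$ where $\binom{\bm{\alpha}}{\bm{\beta}}=\prod_{i=1}^d\binom{\alpha_i}{\beta_i}$ and the remainder $O(h)$ is a polynomial in $h$.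
   Context: $\mathbb{N}$ is the set of nonnegative integers; $\|\bm{\alpha}\|_1=\alpha_1+\cdots+\alpha_d$; $\bm{\beta}\le\bm{\alpha}$ is the componentwise order on $\mathbb{N}^d$. For $\bm{\rho}_i=(\rho_{i,1},\ldots,\rho_{i,d})$, $D^{\bm{\alpha}}_{\bm{\rho}}f=\partial^{\|\bm{\alpha}\|_1}f/\partial\bm{\rho}_1^{\alpha_1}\cdots\partial\bm{\rho}_d^{\alpha_d}$, where $\partial/\partial\bm{\rho}_i=\sum_{j=1}^d\rho_{i,j}\,\partial/\partial x_j$ is the directional derivative. $O(h)$ is understood as $h\to0$ with $\bm{\rho},\bm{\alpha},\bm{\xi},p$ fixed; thus the remainder is a polynomial in $h$ (with coefficients in $\mathbb{F}$ independent of $h$) with zero constant term. *)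

theory Defs
  imports
    "HOL-Analysis.Analysis"
    "HOL-Library.Poly_Mapping"
    "HOL-Library.Landau_Symbols"
    "HOL-Computational_Algebra.Polynomial"
begin

text \<open>
  The scalar field is a type of class \<open>real_normed_field\<close>. The types \<open>real\<close> and \<open>complex\<close>
  are instances, and by the Gelfand--Mazur theorem every instance is isometrically isomorphic
  to one of them. Coordinates are indexed by a finite linearly ordered type \<open>'d\<close>, which plays
  the role of \<open>{1, ..., d}\<close>; the order fixes the order in which iterated derivatives are taken.
  A matrix \<open>\<rho> :: 'a ^ 'd ^ 'd\<close> represents the tuple of its rows \<open>\<rho> $ i\<close>.
\<close>

text \<open>Polynomials in the indeterminates \<open>x\<^sub>i\<close>, \<open>i :: 'd\<close>: finitely supported maps from
  exponent vectors to coefficients.\<close>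

type_synonym ('d, 'a) mpoly = "('d \<Rightarrow>\<^sub>0 nat) \<Rightarrow>\<^sub>0 'a"

definition mpoly_eval :: "('d::finite, 'a::comm_semiring_1) mpoly \<Rightarrow> 'a ^ 'd \<Rightarrow> 'a" where
  "mpoly_eval p x =
     (\<Sum>m\<in>Poly_Mapping.keys p. Poly_Mapping.lookup p m * (\<Prod>i\<in>UNIV. (x $ i) ^ Poly_Mapping.lookup m i))"

definition lin_indep_tuple :: "'a::field ^ 'd::finite ^ 'd \<Rightarrow> bool" where
  "lin_indep_tuple \<rho> \<longleftrightarrow> inj (\<lambda>i. \<rho> $ i) \<and> vec.independent (range (\<lambda>i. \<rho> $ i))"

definition partial_deriv ::
    "'d::finite \<Rightarrow> ('a::real_normed_field ^ 'd \<Rightarrow> 'a) \<Rightarrow> 'a ^ 'd \<Rightarrow> 'a" where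
  "partial_deriv j f x = deriv (\<lambda>t. f (x + axis j t)) 0"

definition dir_deriv ::
    "'a::real_normed_field ^ 'd::finite \<Rightarrow> ('a ^ 'd \<Rightarrow> 'a) \<Rightarrow> 'a ^ 'd \<Rightarrow> 'a" where
  "dir_deriv v f x = (\<Sum>j\<in>UNIV. v $ j * partial_deriv j f x)"

definition mixed_dir_deriv ::
    "'a::real_normed_field ^ ('d::{finite,linorder}) ^ ('d::{finite,linorder}) \<Rightarrow> (('d::{finite,linorder}) \<Rightarrow> nat) \<Rightarrow>
      ('a ^ ('d::{finite,linorder}) \<Rightarrow> 'a) \<Rightarrow> 'a ^ ('d::{finite,linorder}) \<Rightarrow> 'a" where
  "mixed_dir_deriv \<rho> \<alpha> f =
     foldr (\<lambda>i. dir_deriv (\<rho> $ i) ^^ \<alpha> i) (sorted_list_of_set UNIV) f"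

definition mi_norm :: "('d::finite \<Rightarrow> nat) \<Rightarrow> nat" where
  "mi_norm \<alpha> = (\<Sum>i\<in>UNIV. \<alpha> i)"

definition mi_choose :: "('d::finite \<Rightarrow> nat) \<Rightarrow> ('d \<Rightarrow> nat) \<Rightarrow> nat" where
  "mi_choose \<alpha> \<beta> = (\<Prod>i\<in>UNIV. \<alpha> i choose \<beta> i)"

text \<open>Sums over the multi-indices below \<open>\<alpha>\<close> are finite, hence not affected by the convention that sums
  over infinite sets vanish.\<close>

lemma finite_multi_indices_le: "finite {\<beta> :: 'd::finite \<Rightarrow> nat. \<beta> \<le> \<alpha>}"
proof -
  have "{\<beta>. \<beta> \<le> \<alpha>} = PiE UNIV (\<lambda>i. {..\<alpha> i})"
    by (auto simp: le_fun_def PiE_def Pi_def)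
  then show ?thesis
    by (simp add: finite_PiE)
qed

end

theory Submission
  imports Defs
begin

text \<open>
  Consider functions \<open>F h x\<close> that are jointly polynomial in the step size \<open>h\<close> and the point \<open>x\<close>.
  The difference quotient \<open>(F h (x + h v) - F h x) / h\<close> extends to a function of the same kind,
  whose value at \<open>h = 0\<close> is the directional derivative of \<open>F 0\<close> along \<open>v\<close>. Iterating this, the
  normalised iterated difference is a polynomial in \<open>h\<close> with constant term the mixed derivative,
  and the iterated difference expands binomially to the sum in the theorem.
\<close>

subsection \<open>Polynomials in the step size and the point\<close>

text \<open>Generating the class by sums and products lets later facts go by induction, with only
  sum and product rules to check. The step is itself a generator, because the difference quotient of
  a product contains \<open>h\<close> explicitly.\<close>

inductive step_poly :: "('a::real_normed_field \<Rightarrow> 'a ^ 'd::finite \<Rightarrow> 'a) \<Rightarrow> bool" where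
  const: "step_poly (\<lambda>h x. c)"
| step: "step_poly (\<lambda>h x. h)"
| coord: "step_poly (\<lambda>h x. x $ i)"
| add: "step_poly f \<Longrightarrow> step_poly g \<Longrightarrow> step_poly (\<lambda>h x. f h x + g h x)"
| mult: "step_poly f \<Longrightarrow> step_poly g \<Longrightarrow> step_poly (\<lambda>h x. f h x * g h x)"

lemma step_poly_sum:
  assumes "\<And>i. i \<in> A \<Longrightarrow> step_poly (f i)"
  shows "step_poly (\<lambda>h x. \<Sum>i\<in>A. f i h x)"
  using assms
  by (induction A rule: infinite_finite_induct) (auto intro: step_poly.intros)

lemma step_poly_prod:
  assumes "\<And>i. i \<in> A \<Longrightarrow> step_poly (f i)"
  shows "step_poly (\<lambda>h x. \<Prod>i\<in>A. f i h x)"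
  using assms
  by (induction A rule: infinite_finite_induct) (auto intro: step_poly.intros)

lemma step_poly_power:
  assumes "step_poly f"
  shows "step_poly (\<lambda>h x. f h x ^ n)"
  using assms by (induction n) (auto intro: step_poly.intros)

lemma step_poly_mpoly_eval: "step_poly (\<lambda>h. mpoly_eval p)"
  unfolding mpoly_eval_def
  by (intro step_poly_sum step_poly_prod step_poly_power step_poly.intros)

text \<open>At a frozen point the final quotient becomes a univariate polynomial in
  \<open>h\<close>, from which the remainder is read off.\<close>

lemma step_poly_eq_poly:
  assumes "step_poly f"
  shows "\<exists>q. \<forall>h. f h x = poly q h"
  using assms
proof induction
  case (const c)
  show ?case by (rule exI[of _ "[:c:]"]) simp
next
  case step
  show ?case by (rule exI[of _ "[:0, 1:]"]) simp
next
  case (coord i)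
  show ?case by (rule exI[of _ "[:x $ i:]"]) simp
next
  case (add f g)
  then show ?case by (metis poly_add)
next
  case (mult f g)
  then show ?case by (metis poly_mult)
qed

text \<open>Supplies the side conditions under which \<open>deriv\<close> obeys the sum and product
  rules, as used in \<open>dir_deriv_add\<close> and \<open>dir_deriv_mult\<close>.\<close>

lemma step_poly_partial_differentiable:
  assumes "step_poly f"
  shows "(\<lambda>t. f h (x + axis j t)) field_differentiable at 0"
  using assms
proof induction
  case (coord i)
  have "(\<lambda>t. (x + axis j t) $ i) = (\<lambda>t. if i = j then x $ i + t else x $ i)"
    by (auto simp: axis_def)
  then show ?case
    by (cases "i = j") (auto intro!: derivative_intros)
qed (auto intro!: derivative_intros)

lemma dir_deriv_const: "dir_deriv v (\<lambda>x. c) x = 0"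
  by (simp add: dir_deriv_def partial_deriv_def)

lemma dir_deriv_coord: "dir_deriv v (\<lambda>x. x $ i) x = v $ i"
proof -
  have pd: "partial_deriv j (\<lambda>x. x $ i) x = (if i = j then 1 else 0)" for j
  proof -
    have "(\<lambda>t. (x + axis j t) $ i) = (\<lambda>t. if i = j then x $ i + t else x $ i)"
      by (auto simp: axis_def)
    then show ?thesis
      by (cases "i = j") (simp_all add: partial_deriv_def)
  qed
  show ?thesis
    unfolding dir_deriv_def pd by (simp add: if_distrib cong: if_cong)
qed

lemma dir_deriv_add:
  assumes "step_poly f" "step_poly g"
  shows "dir_deriv v (\<lambda>x. f h x + g h x) x = dir_deriv v (f h) x + dir_deriv v (g h) x"
  using assms
  by (simp add: dir_deriv_def partial_deriv_def step_poly_partial_differentiable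
      sum.distrib distrib_left)

lemma axis_zero: "axis j 0 = 0"
  by (simp add: axis_def vec_eq_iff)

lemma dir_deriv_mult:
  assumes "step_poly f" "step_poly g"
  shows "dir_deriv v (\<lambda>x. f h x * g h x) x
    = f h x * dir_deriv v (g h) x + dir_deriv v (f h) x * g h x"
  using assms
  by (simp add: dir_deriv_def partial_deriv_def step_poly_partial_differentiable axis_zero
      sum.distrib distrib_left sum_distrib_left sum_distrib_right mult_ac)

subsection \<open>Forward differences\<close>

definition fwd_diff :: "'a::real_normed_field ^ 'd \<Rightarrow> ('a ^ 'd \<Rightarrow> 'a) \<Rightarrow> 'a ^ 'd \<Rightarrow> 'a" where
  "fwd_diff v f x = f (x + v) - f x"

lemma fwd_diff_scale: "fwd_diff v (\<lambda>x. c * f x) = (\<lambda>x. c * fwd_diff v f x)"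
  by (simp add: fwd_diff_def fun_eq_iff right_diff_distrib)

text \<open>The quotient is built along the structure of \<open>f\<close> rather than by division,
  so it is defined at \<open>h = 0\<close> too. Its value there must be tracked separately, since
  the difference equation at \<open>h = 0\<close> only says 0 = 0.\<close>

lemma fwd_diff_step_poly:
  assumes "step_poly f"
  shows "\<exists>g. step_poly g \<and> (\<forall>h. fwd_diff (h *s v) (f h) = (\<lambda>x. h * g h x))
    \<and> g 0 = dir_deriv v (f 0)"
  using assms
proof induction
  case (const c)
  show ?case
    by (rule exI[of _ "\<lambda>h x. 0"])
      (auto simp: fwd_diff_def dir_deriv_const intro: step_poly.intros)
next
  case step
  show ?case
    by (rule exI[of _ "\<lambda>h x. 0"])
      (auto simp: fwd_diff_def dir_deriv_const intro: step_poly.intros)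
next
  case (coord i)
  show ?case
    by (rule exI[of _ "\<lambda>h x. v $ i"])
      (auto simp: fwd_diff_def dir_deriv_coord intro: step_poly.intros)
next
  case (add f1 f2)
  then obtain g1 g2 where g: "step_poly g1" "step_poly g2"
      "\<And>h. fwd_diff (h *s v) (f1 h) = (\<lambda>x. h * g1 h x)"
      "\<And>h. fwd_diff (h *s v) (f2 h) = (\<lambda>x. h * g2 h x)"
      "g1 0 = dir_deriv v (f1 0)" "g2 0 = dir_deriv v (f2 0)"
    by blast
  have shift: "f1 h (x + h *s v) = f1 h x + h * g1 h x"
      "f2 h (x + h *s v) = f2 h x + h * g2 h x" for h x
    using g(3,4)[of h] by (simp_all add: fwd_diff_def fun_eq_iff algebra_simps)
  show ?case
  proof (intro exI[of _ "\<lambda>h x. g1 h x + g2 h x"] conjI allI)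
    show "step_poly (\<lambda>h x. g1 h x + g2 h x)"
      by (intro step_poly.intros g)
  qed (simp_all add: fun_eq_iff fwd_diff_def shift dir_deriv_add add.hyps g algebra_simps)
next
  case (mult f1 f2)
  then obtain g1 g2 where g: "step_poly g1" "step_poly g2"
      "\<And>h. fwd_diff (h *s v) (f1 h) = (\<lambda>x. h * g1 h x)"
      "\<And>h. fwd_diff (h *s v) (f2 h) = (\<lambda>x. h * g2 h x)"
      "g1 0 = dir_deriv v (f1 0)" "g2 0 = dir_deriv v (f2 0)"
    by blast
  have shift: "f1 h (x + h *s v) = f1 h x + h * g1 h x"
      "f2 h (x + h *s v) = f2 h x + h * g2 h x" for h x
    using g(3,4)[of h] by (simp_all add: fwd_diff_def fun_eq_iff algebra_simps)
  show ?case
  \<comment> \<open>Discrete Leibniz rule: expand (f1 + h g1)(f2 + h g2) - f1 f2 and take out one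
    factor h. At \<open>h = 0\<close> the extra term vanishes and the ordinary product rule
    remains.\<close>
  proof (intro exI[of _ "\<lambda>h x. g1 h x * (f2 h x + h * g2 h x) + f1 h x * g2 h x"] conjI allI)
    show "step_poly (\<lambda>h x. g1 h x * (f2 h x + h * g2 h x) + f1 h x * g2 h x)"
      by (intro step_poly.intros g mult.hyps)
  qed (simp_all add: fun_eq_iff fwd_diff_def shift dir_deriv_mult mult.hyps g algebra_simps)
qed

text \<open>Each further difference acts on the previous quotient, which already depends on
  \<open>h\<close>; the powers of \<open>h\<close> collected so far pass through by
  linearity.\<close>

lemma fwd_diff_funpow_step_poly:
  assumes "step_poly f"
  shows "\<exists>g. step_poly g \<and> (\<forall>h. (fwd_diff (h *s v) ^^ n) (f h) = (\<lambda>x. h ^ n * g h x))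
    \<and> g 0 = (dir_deriv v ^^ n) (f 0)"
proof (induction n)
  case 0
  show ?case
    using assms by (intro exI[of _ f]) simp
next
  case (Suc n)
  then obtain g where g: "step_poly g"
      "\<And>h. (fwd_diff (h *s v) ^^ n) (f h) = (\<lambda>x. h ^ n * g h x)"
      "g 0 = (dir_deriv v ^^ n) (f 0)"
    by blast
  obtain k where "step_poly k" "\<And>h. fwd_diff (h *s v) (g h) = (\<lambda>x. h * k h x)"
      "k 0 = dir_deriv v (g 0)"
    using fwd_diff_step_poly[OF g(1)] by blast
  then show ?case
    using g by (intro exI[of _ k]) (simp add: fwd_diff_scale mult_ac)
qed

lemma fwd_diff_funpow_scale:
  "(fwd_diff v ^^ n) (\<lambda>x. c * f x) = (\<lambda>x. c * (fwd_diff v ^^ n) f x)"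
  by (induction n) (simp_all add: fwd_diff_scale)

text \<open>Differences and derivatives are folded over the same list, so they match factor by
  factor without any interchange of derivatives.\<close>

lemma foldr_fwd_diff_step_poly:
  assumes "step_poly f"
  shows "\<exists>g. step_poly g
    \<and> (\<forall>h. foldr (\<lambda>i. fwd_diff (h *s \<rho> i) ^^ \<alpha> i) xs (f h) = (\<lambda>x. h ^ sum_list (map \<alpha> xs) * g h x))
    \<and> g 0 = foldr (\<lambda>i. dir_deriv (\<rho> i) ^^ \<alpha> i) xs (f 0)"
proof (induction xs)
  case Nil
  show ?case
    using assms by (intro exI[of _ f]) simp
next
  case (Cons i xs)
  then obtain g where g: "step_poly g"
      "\<And>h. foldr (\<lambda>i. fwd_diff (h *s \<rho> i) ^^ \<alpha> i) xs (f h)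
        = (\<lambda>x. h ^ sum_list (map \<alpha> xs) * g h x)"
      "g 0 = foldr (\<lambda>i. dir_deriv (\<rho> i) ^^ \<alpha> i) xs (f 0)"
    by blast
  obtain k where "step_poly k"
      "\<And>h. (fwd_diff (h *s \<rho> i) ^^ \<alpha> i) (g h) = (\<lambda>x. h ^ \<alpha> i * k h x)"
      "k 0 = (dir_deriv (\<rho> i) ^^ \<alpha> i) (g 0)"
    using fwd_diff_funpow_step_poly[OF g(1)] by blast
  then show ?case
    using g
    by (intro exI[of _ k]) (simp add: fwd_diff_funpow_scale power_add mult.assoc mult.left_commute)
qed

section \<open>Binomial expansion of iterated differences\<close>

lemma fwd_diff_funpow_eq_sum:
  "(fwd_diff v ^^ n) f x
    = (\<Sum>k\<le>n. (- 1) ^ (n - k) * of_nat (n choose k) * f (x + of_nat k *s v))"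
proof -
  \<comment> \<open>With sign exponent \<open>n + k\<close> the Pascal recursion below needs no case distinction.\<close>
  define c :: "nat \<Rightarrow> nat \<Rightarrow> 'a" where "c n k = (- 1) ^ (n + k) * of_nat (n choose k)" for n k
  have "(fwd_diff v ^^ n) f x = (\<Sum>k\<le>n. c n k * f (x + of_nat k *s v))"
  proof (induction n arbitrary: x)
    case 0
    show ?case by (simp add: c_def)
  next
    case (Suc n)
    let ?f = "\<lambda>k. f (x + of_nat k *s v)"
    have shift: "x + v + of_nat k *s v = x + of_nat (Suc k) *s v" for k
      by (simp add: algebra_simps)
    have c0: "c (Suc n) 0 = - c n 0" and c_last: "c n (Suc n) = 0"
      and c_Suc: "c (Suc n) (Suc k) = c n k - c n (Suc k)" for k
      by (simp_all add: c_def algebra_simps)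
    \<comment> \<open>The second sum gains the term k = n + 1, which is zero by
      \<open>c_last\<close>. Splitting off k = 0 then leaves sums over one range, and
      \<open>c_Suc\<close> (Pascal's rule) compares coefficients.\<close>
    have "(fwd_diff v ^^ Suc n) f x
        = (\<Sum>k\<le>n. c n k * ?f (Suc k)) - (\<Sum>k\<le>Suc n. c n k * ?f k)"
      using c_last by (simp add: fwd_diff_def Suc shift)
    also have "\<dots> = (\<Sum>k\<le>Suc n. c (Suc n) k * ?f k)"
      by (simp only: sum.atMost_Suc_shift c0 c_Suc)
        (simp add: sum_subtractf left_diff_distrib del: of_nat_Suc)
    finally show ?case .
  qed
  also have "\<dots> = (\<Sum>k\<le>n. (- 1) ^ (n - k) * of_nat (n choose k) * f (x + of_nat k *s v))"
  proof (rule sum.cong)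
    fix k
    assume "k \<in> {..n}"
    then obtain m where "n = k + m"
      by (auto simp: le_iff_add)
    \<comment> \<open>The exponents differ by the even number 2k.\<close>
    then have "(- 1 :: 'a) ^ (n + k) = (- 1) ^ (n - k)"
      by (simp add: power_add mult_ac flip: power_mult_distrib)
    then show "c n k * f (x + of_nat k *s v)
        = (- 1) ^ (n - k) * of_nat (n choose k) * f (x + of_nat k *s v)"
      by (simp add: c_def)
  qed simp
  finally show ?thesis .
qed

text \<open>Multi-indices are padded with zeros outside \<open>xs\<close>, so that they keep a
  single type throughout the induction; when \<open>xs\<close> enumerates the whole type, the
  padding condition is vacuous.\<close>

lemma foldr_fwd_diff_eq_sum:
  fixes v :: "'d::finite \<Rightarrow> 'a::real_normed_field ^ 'd"
  assumes "distinct xs"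
  shows "foldr (\<lambda>i. fwd_diff (v i) ^^ \<alpha> i) xs f x
    = (\<Sum>\<beta> | \<beta> \<le> \<alpha> \<and> (\<forall>i. i \<notin> set xs \<longrightarrow> \<beta> i = 0).
        (\<Prod>i\<in>set xs. (- 1) ^ (\<alpha> i - \<beta> i) * of_nat (\<alpha> i choose \<beta> i)) *
        f (x + (\<Sum>i\<in>set xs. of_nat (\<beta> i) *s v i)))"
  using assms
proof (induction xs arbitrary: x)
  case Nil
  have "{\<beta>. \<beta> \<le> \<alpha> \<and> (\<forall>i. \<beta> i = 0)} = {\<lambda>i. 0}"
    by (auto simp: le_fun_def)
  then show ?case by simp
next
  case (Cons j xs)
  define B where "B ys = {\<beta>. \<beta> \<le> \<alpha> \<and> (\<forall>i. i \<notin> set ys \<longrightarrow> \<beta> i = 0)}" for ys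
  define c :: "'d \<Rightarrow> nat \<Rightarrow> 'a" where "c i k = (- 1) ^ (\<alpha> i - k) * of_nat (\<alpha> i choose k)" for i k
  have j: "j \<notin> set xs" and IH: "foldr (\<lambda>i. fwd_diff (v i) ^^ \<alpha> i) xs f x
      = (\<Sum>\<beta>\<in>B xs. (\<Prod>i\<in>set xs. c i (\<beta> i)) * f (x + (\<Sum>i\<in>set xs. of_nat (\<beta> i) *s v i)))" for x
    using Cons by (simp_all add: B_def c_def)
  have prod: "(\<Prod>i\<in>set (j # xs). c i ((\<beta>(j := k)) i)) = c j k * (\<Prod>i\<in>set xs. c i (\<beta> i))" for \<beta> k
    using j by (auto intro!: prod.cong)
  have pt: "(\<Sum>i\<in>set (j # xs). of_nat ((\<beta>(j := k)) i) *s v i)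
      = of_nat k *s v j + (\<Sum>i\<in>set xs. of_nat (\<beta> i) *s v i)" for \<beta> k
    using j by (auto intro!: sum.cong)
  have "foldr (\<lambda>i. fwd_diff (v i) ^^ \<alpha> i) (j # xs) f x
      = (\<Sum>(k, \<beta>)\<in>{..\<alpha> j} \<times> B xs. c j k * ((\<Prod>i\<in>set xs. c i (\<beta> i)) *
          f (x + of_nat k *s v j + (\<Sum>i\<in>set xs. of_nat (\<beta> i) *s v i))))"
    by (simp add: fwd_diff_funpow_eq_sum IH sum.cartesian_product sum_distrib_left
        flip: c_def)
  also have "\<dots> = (\<Sum>\<beta>\<in>B (j # xs). (\<Prod>i\<in>set (j # xs). c i (\<beta> i)) *
      f (x + (\<Sum>i\<in>set (j # xs). of_nat (\<beta> i) *s v i)))"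
  \<comment> \<open>A multi-index supported on \<open>j # xs\<close> is split into its entry at
    \<open>j\<close> and the rest. Resetting that entry to 0 recovers \<beta>, because
    \<open>j\<close> is not in \<open>xs\<close>.\<close>
  proof (rule sum.reindex_bij_witness
      [where i = "\<lambda>\<beta>. (\<beta> j, \<beta>(j := 0))" and j = "\<lambda>(k, \<beta>). \<beta>(j := k)"])
    fix a
    assume "a \<in> {..\<alpha> j} \<times> B xs"
    then obtain k \<beta> where a: "a = (k, \<beta>)" "k \<le> \<alpha> j" "\<beta> \<in> B xs"
      by auto
    then show "(case a of (k, \<beta>) \<Rightarrow> \<beta>(j := k)) \<in> B (j # xs)"
      by (auto simp: B_def le_fun_def)
    have "\<beta> j = 0"
      using a j by (auto simp: B_def)
    then show "((case a of (k, \<beta>) \<Rightarrow> \<beta>(j := k)) j, (case a of (k, \<beta>) \<Rightarrow> \<beta>(j := k))(j := 0)) = a"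
      using a by auto
    show "(\<Prod>i\<in>set (j # xs). c i ((case a of (k, \<beta>) \<Rightarrow> \<beta>(j := k)) i)) *
        f (x + (\<Sum>i\<in>set (j # xs). of_nat ((case a of (k, \<beta>) \<Rightarrow> \<beta>(j := k)) i) *s v i))
      = (case a of (k, \<beta>) \<Rightarrow> c j k * ((\<Prod>i\<in>set xs. c i (\<beta> i)) *
          f (x + of_nat k *s v j + (\<Sum>i\<in>set xs. of_nat (\<beta> i) *s v i))))"
      unfolding a(1) prod.case prod pt by (simp add: mult.assoc add.assoc)
  qed (auto simp: B_def le_fun_def)
  finally show ?case
    by (simp only: B_def c_def)
qed

section \<open>The remainder and the assembly of the result\<close>

lemma poly_bigo_at_0:
  fixes r :: "'a::real_normed_field poly"
  assumes "coeff r 0 = 0"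
  shows "poly r \<in> O[at 0](\<lambda>h. h)"
proof -
  \<comment> \<open>Here \<open>r\<close> is X times \<open>s\<close>, so away from 0 the quotient
    by h is \<open>poly s h\<close>, which has a limit at 0.\<close>
  obtain s where r: "r = pCons 0 s"
    using assms by (cases r) auto
  have "((\<lambda>h. poly r h / h) \<longlongrightarrow> poly s 0) (at 0)"
  proof (rule Lim_transform_eventually)
    show "(poly s \<longlongrightarrow> poly s 0) (at 0)"
      using poly_isCont[of 0 s] by (simp add: isCont_def)
    show "\<forall>\<^sub>F h in at 0. poly s h = poly r h / h"
      by (auto simp: r eventually_at_filter)
  qed
  then show ?thesis
    by (rule bigoI_tendsto) (auto simp: eventually_at_filter)
qed

theorem proposition4:
  fixes \<rho> :: "'a::real_normed_field ^ ('d::{finite,linorder}) ^ ('d::{finite,linorder})"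
    and \<alpha> :: "('d::{finite,linorder}) \<Rightarrow> nat"
    and \<xi> :: "'a ^ ('d::{finite,linorder})"
    and p :: "(('d::{finite,linorder}), 'a) mpoly"
  assumes "lin_indep_tuple \<rho>"
    and "\<And>i. norm (\<rho> $ i) = 1"
  shows "\<exists>r :: 'a poly. coeff r 0 = 0 \<and> poly r \<in> O[at 0](\<lambda>h. h) \<and>
    (\<forall>h. h \<noteq> 0 \<longrightarrow>
      1 / h ^ mi_norm \<alpha> *
        (\<Sum>\<beta> | \<beta> \<le> \<alpha>. (- 1) ^ mi_norm (\<lambda>i. \<alpha> i - \<beta> i) * of_nat (mi_choose \<alpha> \<beta>) *
           mpoly_eval p (\<xi> + h *s (\<Sum>i\<in>UNIV. of_nat (\<beta> i) *s (\<rho> $ i))))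
      = mixed_dir_deriv \<rho> \<alpha> (mpoly_eval p) \<xi> + poly r h)"
proof -
  obtain g where g: "step_poly g"
      "\<And>h. foldr (\<lambda>i. fwd_diff (h *s \<rho> $ i) ^^ \<alpha> i) (sorted_list_of_set UNIV) (mpoly_eval p)
        = (\<lambda>x. h ^ sum_list (map \<alpha> (sorted_list_of_set UNIV)) * g h x)"
      "g 0 = mixed_dir_deriv \<rho> \<alpha> (mpoly_eval p)"
    using foldr_fwd_diff_step_poly[OF step_poly_mpoly_eval, where \<rho> = "\<lambda>i. \<rho> $ i"]
    unfolding mixed_dir_deriv_def by blast
  obtain q where q: "\<And>h. g h \<xi> = poly q h"
    using step_poly_eq_poly[OF g(1)] by blast
  \<comment> \<open>The removed constant term is \<open>g 0\<close> at \<xi>, that is, the mixed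
    derivative.\<close>
  define r where "r = q - [:poly q 0:]"
  have r0: "coeff r 0 = 0"
    by (simp add: r_def poly_0_coeff_0)
  have norm: "sum_list (map \<alpha> (sorted_list_of_set UNIV)) = mi_norm \<alpha>"
    by (simp add: mi_norm_def sum_list_distinct_conv_sum_set)
  have diff: "(\<Sum>\<beta> | \<beta> \<le> \<alpha>. (- 1) ^ mi_norm (\<lambda>i. \<alpha> i - \<beta> i) * of_nat (mi_choose \<alpha> \<beta>) *
      mpoly_eval p (\<xi> + h *s (\<Sum>i\<in>UNIV. of_nat (\<beta> i) *s (\<rho> $ i)))) = h ^ mi_norm \<alpha> * g h \<xi>" for h
  proof -
    \<comment> \<open>Moving \<open>h\<close> onto the directions turns the evaluation points into
      those of differences along \<open>h *s \<rho> $ i\<close>.\<close>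
    have "h *s (\<Sum>i\<in>UNIV. of_nat (\<beta> i) *s (\<rho> $ i))
        = (\<Sum>i\<in>UNIV. of_nat (\<beta> i) *s (h *s \<rho> $ i))" for \<beta> :: "'d \<Rightarrow> nat"
      by (simp add: vec.scale_sum_right mult.commute)
    moreover have "h ^ mi_norm \<alpha> * g h \<xi>
        = foldr (\<lambda>i. fwd_diff (h *s \<rho> $ i) ^^ \<alpha> i) (sorted_list_of_set UNIV) (mpoly_eval p) \<xi>"
      by (simp add: g(2) norm)
    ultimately show ?thesis
      by (simp add: foldr_fwd_diff_eq_sum mi_norm_def mi_choose_def power_sum prod.distrib)
  qed
  have "1 / h ^ mi_norm \<alpha> * (h ^ mi_norm \<alpha> * g h \<xi>)
      = mixed_dir_deriv \<rho> \<alpha> (mpoly_eval p) \<xi> + poly r h" if "h \<noteq> 0" for h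
    using that by (simp add: r_def q flip: g(3))
  then show ?thesis
    using r0 poly_bigo_at_0[OF r0] unfolding diff by blast
qed

end
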